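(* Consider the $n$-step binomial model with parameters $m,n\ge1$, $R\ge1$, $0<D_i<R<U_i$ and $S_i(0)>0$ ($1\le i\le m$), $C\ge0$, and let $b(i)=\frac{2R-U_i-D_i}{U_i-D_i}$ for $1\le i\le m$, where the indices are ordered so that $b(1)\ge\dots\ge b(m)$. Assume the set $\Gamma_*$ of risk-neutral measures is non-empty. Let $F$ be the pay-off and, for $P_*\in\Gamma_*$, let $H_{P_*}$ be its rational value. Let $\omega=\lambda_1\cdots\lambda_n\in\mathcal L^n$, $1\le k\le n$, and $\theta=\lambda_1\cdots\lambda_{n-k}$. Then $$\sup_{P_*\in\Gamma_*}H_{P_*}(n-k)(\omega)=E_{q^*}(F_{\theta-})=\sum_{i_0+\dots+i_m=k}\frac{k!}{i_0!\cdots i_m!}\,b'(0)^{i_0}\cdots b'(m)^{i_m}\,F(\theta\mu_0^{i_0}\cdots\mu_m^{i_m}).$$ If $\frac1m\sum_{i=1}^m b(i)\le\frac2m-1$ then $$\inf_{P_*\in\Gamma_*}H_{P_*}(n-k)(\omega)=E_{q_*}(F_{\theta-})=\sum_{i_0+\dots+i_m=k}\frac{k!}{i_0!\cdots i_m!}\,b''(0)^{i_0}\cdots b''(m)^{i_m}\,F(\theta\nu_0^{i_0}\cdots\nu_m^{i_m}).$$ The sums run over tuples of non-negative integers with sum $k$.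
   Context: $\mathcal L$ is the set of all functions $\lambda:\{1,\dots,m\}\to\{0,1\}$; the sample space is $\mathcal L^n$, whose elements are written as words $\lambda_1\cdots\lambda_n$; juxtaposition is concatenation and $\lambda^j$ denotes the word $\lambda\cdots\lambda$ of length $j$. The model: for $0\le k\le n$ and $1\le i\le m$, $S_i(k):\mathcal L^n\to\mathbb R$ is $S_i(k)(\lambda_1\cdots\lambda_n)=S_i(0)\,D_i^{\sum_{j=1}^k\lambda_j(i)}\,U_i^{\,k-\sum_{j=1}^k\lambda_j(i)}$. The pay-off is $F(\lambda_1\cdots\lambda_n)=\max\{0,\sum_{i=1}^m S_i(n)(\lambda_1\cdots\lambda_n)-C\}$. For $\omega\in\mathcal L^n$ and $0\le k\le n$, $E_{k,\omega}=\bigcap_{t=0}^k\bigcap_{i=1}^m\{\omega'\in\mathcal L^n: S_i(t)(\omega')=S_i(t)(\omega)\}$. A risk-neutral measure is a probability measure $P_*$ on $\mathcal L^n$ with $P_*(\omega)>0$ for all $\omega$ and $E_{P_*}(S_i(k+\ell)\mid E_{k,\omega})=R^\ell S_i(k)(\omega)$ for all $1\le i\le m$, $\omega\in\mathcal L^n$, and $k,\ell\ge0$ with $k+\ell\le n$. $\Gamma_*$ is the set of all risk-neutral measures. The rational value of $F$ with respect to $P_*\in\Gamma_*$ is (without discounting) $H_{P_*}(k)(\omega)=E_{P_*}(F\mid E_{k,\omega})$. Set $b(0)=1$, $b(m+1)=-1$. For $0\le i\le m$: $b'(i)=\frac{b(i)-b(i+1)}2$, and $\mu_i\in\mathcal L$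 is $\mu_i(j)=0$ if $j\le i$, $\mu_i(j)=1$ if $j\ge i+1$. Further $\nu_i\in\mathcal L$ is $\nu_i(j)=1-\delta_{ij}$ ($1\le j\le m$), $b''(i)=\frac{b(i)+1}2$ for $1\le i\le m$, $b''(0)=1-\sum_{i=1}^m b''(i)$. With $e_\lambda$ the standard basis of $\mathbb R^{\mathcal L}$, $q^*=\sum_{i=0}^m b'(i)e_{\mu_i}$ and $q_*=\sum_{i=0}^m b''(i)e_{\nu_i}$; $q^*$ is a probability density on $\mathcal L$, and so is $q_*$ when $\frac1m\sum b(i)\le\frac2m-1$. For $\theta\in\mathcal L^{n-k}$, $F_{\theta-}:\mathcal L^k\to\mathbb R$ is $F_{\theta-}(\tau)=F(\theta\tau)$. For a density $p$ on $\mathcal L$, $E_p$ of a function on $\mathcal L^k$ is the expectation with respect to the product measure $p^{\otimes k}$. Convention: $0^0=1$. *)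

theory Defs
  imports "HOL-Probability.Probability"
begin

section \<open>The sample space\<close>

definition scenarios :: "nat \<Rightarrow> (nat \<Rightarrow> nat) set" where
  "scenarios m = {1..m} \<rightarrow>\<^sub>E {0, 1}"

text \<open>
  A word \<open>\<lambda>\<^sub>1\<dots>\<lambda>\<^sub>n\<close> is a list; its letter \<open>\<lambda>\<^sub>j\<close> is the list entry with index \<open>j - 1\<close>,
  and juxtaposition is \<open>@\<close>.
\<close>

definition words :: "nat \<Rightarrow> nat \<Rightarrow> (nat \<Rightarrow> nat) list set" where
  "words m n = {w. set w \<subseteq> scenarios m \<and> length w = n}"


section \<open>The multi-asset binomial model\<close>

text \<open>The value 1 of a letter at \<open>i\<close> is a down-move of asset \<open>i\<close> and the value 0 an up-move.\<close>

definition stock ::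
  "(nat \<Rightarrow> real) \<Rightarrow> (nat \<Rightarrow> real) \<Rightarrow> (nat \<Rightarrow> real) \<Rightarrow> nat \<Rightarrow> nat \<Rightarrow> (nat \<Rightarrow> nat) list \<Rightarrow> real" where
  "stock S0 D U i k w =
     S0 i * D i ^ (\<Sum>j<k. (w ! j) i) * U i ^ (k - (\<Sum>j<k. (w ! j) i))"

definition payoff ::
  "nat \<Rightarrow> nat \<Rightarrow> (nat \<Rightarrow> real) \<Rightarrow> (nat \<Rightarrow> real) \<Rightarrow> (nat \<Rightarrow> real) \<Rightarrow> real
    \<Rightarrow> (nat \<Rightarrow> nat) list \<Rightarrow> real" where
  "payoff m n S0 D U C w = max 0 ((\<Sum>i=1..m. stock S0 D U i n w) - C)"

definition history_event ::
  "nat \<Rightarrow> nat \<Rightarrow> (nat \<Rightarrow> real) \<Rightarrow> (nat \<Rightarrow> real) \<Rightarrow> (nat \<Rightarrow> real) \<Rightarrow> nat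
    \<Rightarrow> (nat \<Rightarrow> nat) list \<Rightarrow> (nat \<Rightarrow> nat) list set" where
  "history_event m n S0 D U k w =
     (\<Inter>t\<in>{0..k}. \<Inter>i\<in>{1..m}. {w' \<in> words m n. stock S0 D U i t w' = stock S0 D U i t w})"

text \<open>
  Elementary conditional expectation given an event; below, the event always has positive
  probability, so that \<^const>\<open>cond_pmf\<close> is the conditional distribution.
\<close>

definition cond_expectation :: "'a pmf \<Rightarrow> ('a \<Rightarrow> real) \<Rightarrow> 'a set \<Rightarrow> real" where
  "cond_expectation P X A = measure_pmf.expectation (cond_pmf P A) X"

definition risk_neutral_measures ::
  "nat \<Rightarrow> nat \<Rightarrow> real \<Rightarrow> (nat \<Rightarrow> real) \<Rightarrow> (nat \<Rightarrow> real) \<Rightarrow> (nat \<Rightarrow> real)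
    \<Rightarrow> (nat \<Rightarrow> nat) list pmf set" where
  "risk_neutral_measures m n R S0 D U =
     {P. set_pmf P \<subseteq> words m n \<and>
         (\<forall>w\<in>words m n. pmf P w > 0) \<and>
         (\<forall>i\<in>{1..m}. \<forall>w\<in>words m n. \<forall>k l. k + l \<le> n \<longrightarrow>
            cond_expectation P (stock S0 D U i (k + l)) (history_event m n S0 D U k w) =
              R ^ l * stock S0 D U i k w)}"

definition rational_value ::
  "nat \<Rightarrow> nat \<Rightarrow> (nat \<Rightarrow> real) \<Rightarrow> (nat \<Rightarrow> real) \<Rightarrow> (nat \<Rightarrow> real) \<Rightarrow> real
    \<Rightarrow> (nat \<Rightarrow> nat) list pmf \<Rightarrow> nat \<Rightarrow> (nat \<Rightarrow> nat) list \<Rightarrow> real" where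
  "rational_value m n S0 D U C P k w =
     cond_expectation P (payoff m n S0 D U C) (history_event m n S0 D U k w)"


section \<open>The extremal one-step densities\<close>

definition bcoef ::
  "nat \<Rightarrow> real \<Rightarrow> (nat \<Rightarrow> real) \<Rightarrow> (nat \<Rightarrow> real) \<Rightarrow> nat \<Rightarrow> real" where
  "bcoef m R D U i =
     (if i = 0 then 1
      else if i = m + 1 then - 1
      else (2 * R - U i - D i) / (U i - D i))"

definition upper_coef :: "(nat \<Rightarrow> real) \<Rightarrow> nat \<Rightarrow> real" where
  "upper_coef b i = (b i - b (i + 1)) / 2"

definition lower_coef :: "nat \<Rightarrow> (nat \<Rightarrow> real) \<Rightarrow> nat \<Rightarrow> real" where
  "lower_coef m b i =
     (if i = 0 then 1 - (\<Sum>j=1..m. (b j + 1) / 2) else (b i + 1) / 2)"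

definition mu :: "nat \<Rightarrow> nat \<Rightarrow> nat \<Rightarrow> nat" where
  "mu m i = (\<lambda>j\<in>{1..m}. if j \<le> i then 0 else 1)"

definition nu :: "nat \<Rightarrow> nat \<Rightarrow> nat \<Rightarrow> nat" where
  "nu m i = (\<lambda>j\<in>{1..m}. if j = i then 0 else 1)"

text \<open>The indicator of \<open>{\<lambda>}\<close> is the standard basis vector \<open>e\<^sub>\<lambda>\<close>.\<close>

definition upper_density :: "nat \<Rightarrow> (nat \<Rightarrow> real) \<Rightarrow> (nat \<Rightarrow> nat) \<Rightarrow> real" where
  "upper_density m b = (\<lambda>x. \<Sum>i=0..m. upper_coef b i * indicator {mu m i} x)"

definition lower_density :: "nat \<Rightarrow> (nat \<Rightarrow> real) \<Rightarrow> (nat \<Rightarrow> nat) \<Rightarrow> real" where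
  "lower_density m b = (\<lambda>x. \<Sum>i=0..m. lower_coef m b i * indicator {nu m i} x)"

text \<open>
  Expectation with respect to the \<open>k\<close>-fold product of the measure with density \<open>p\<close>. This is
  meaningful only if \<open>p\<close> is nonnegative with total mass 1, since otherwise \<^const>\<open>embed_pmf\<close>
  is unspecified.
\<close>

definition product_expectation ::
  "('a \<Rightarrow> real) \<Rightarrow> nat \<Rightarrow> ('a list \<Rightarrow> real) \<Rightarrow> real" where
  "product_expectation p k f = measure_pmf.expectation (replicate_pmf k (embed_pmf p)) f"

definition compositions :: "nat \<Rightarrow> nat \<Rightarrow> (nat \<Rightarrow> nat) set" where
  "compositions m k = {a \<in> {0..m} \<rightarrow>\<^sub>E UNIV. (\<Sum>j=0..m. a j) = k}"

text \<open>The word \<open>x\<^sub>0\<^bsup>a\<^sub>0\<^esup>\<dots>x\<^sub>m\<^bsup>a\<^sub>m\<^esup>\<close>.\<close>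

definition block_word :: "nat \<Rightarrow> (nat \<Rightarrow> 'a) \<Rightarrow> (nat \<Rightarrow> nat) \<Rightarrow> 'a list" where
  "block_word m x a = concat (map (\<lambda>j. replicate (a j) (x j)) [0..<Suc m])"

end

theory Submission
  imports Defs
begin

text \<open>
  As a function of a single letter the pay-off is \<open>max 0 (K + \<Sum>\<^sub>i a\<^sub>i z\<^sub>i)\<close> with \<open>a\<^sub>i \<ge> 0\<close> and
  \<open>z\<^sub>i \<in> {0, 1}\<close> indicating an up-move of asset \<open>i\<close>. Such a function lies below the affine
  function of \<open>z\<close> that agrees with it on the chain \<open>\<mu>\<^sub>0, \<dots>, \<mu>\<^sub>m\<close>, and above the one that agrees
  with it on \<open>\<nu>\<^sub>0, \<dots>, \<nu>\<^sub>m\<close>. Risk neutrality fixes the conditional probability of each up-move, and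
  hence the conditional expectation of every affine function of \<open>z\<close>, so backward induction bounds
  the rational value by the expectations under \<open>q\<^sup>*\<close> and \<open>q\<^sub>*\<close>. Both bounds are limits of values of
  risk-neutral product measures, whose one-step laws are perturbations of the extremal densities
  towards a fully supported one. The multinomial formula holds since the pay-off is invariant under
  permutations of the letters.
\<close>

section \<open>Affine bounds for the positive part of a sum\<close>

text \<open>Induction over the assets. As \<open>max 0\<close> is convex, adding \<open>a i\<close>
  raises it the more, the larger the base point; the coefficient uses the largest base point that
  the earlier assets can reach, namely all of them up.\<close>

lemma max_sum_le_greedy:
  fixes K :: real and a z :: "nat \<Rightarrow> real"
  assumes "\<And>i. 1 \<le> i \<Longrightarrow> i \<le> m \<Longrightarrow> a i \<ge> 0 \<and> z i \<in> {0, 1}"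
  shows "max 0 (K + (\<Sum>i=1..m. a i * z i)) \<le>
    max 0 K + (\<Sum>i=1..m. (max 0 (K + sum a {1..i}) - max 0 (K + sum a {1..<i})) * z i)"
  using assms
proof (induction m)
  case (Suc m)
  have IH: "max 0 (K + (\<Sum>i=1..m. a i * z i)) \<le>
      max 0 K + (\<Sum>i=1..m. (max 0 (K + sum a {1..i}) - max 0 (K + sum a {1..<i})) * z i)"
    using Suc by auto
  have "(\<Sum>i=1..m. a i * z i) \<le> (\<Sum>i=1..m. a i)"
    by (rule sum_mono) (use Suc.prems in \<open>force simp: mult_left_le\<close>)
  moreover have "{1..<Suc m} = {1..m}" by auto
  moreover have "a (Suc m) \<ge> 0" "z (Suc m) = 0 \<or> z (Suc m) = 1"
    using Suc.prems[of "Suc m"] by auto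
  \<comment> \<open>Convexity in isolation: \<open>s\<close> is the actual sum of the earlier
    assets, \<open>S\<close> the maximal one, and \<open>t\<close> the contribution of the new
    asset.\<close>
  moreover have step: "max 0 (K + (s + t)) \<le> r + (max 0 (K + (S + t)) - max 0 (K + S))"
    if "max 0 (K + s) \<le> r" "s \<le> S" "t \<ge> 0" for r s S t :: real
    using that by (simp add: max_def split: if_splits)
  ultimately show ?case
    using IH step[OF IH] by (elim disjE) (simp_all add: add.assoc del: max_less_iff_conj)
qed simp

text \<open>On the chain an asset is up only if all earlier ones are, so the actual base point is
  the maximal one and the coefficients telescope.\<close>

lemma max_sum_eq_greedy:
  fixes K :: real and a z :: "nat \<Rightarrow> real"
  assumes "\<And>i. 1 \<le> i \<Longrightarrow> i \<le> m \<Longrightarrow> z i = of_bool (i \<le> p)"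
  shows "max 0 (K + (\<Sum>i=1..m. a i * z i)) =
    max 0 K + (\<Sum>i=1..m. (max 0 (K + sum a {1..i}) - max 0 (K + sum a {1..<i})) * z i)"
  using assms
proof (induction m)
  case (Suc m)
  have IH: "max 0 (K + (\<Sum>i=1..m. a i * z i)) =
      max 0 K + (\<Sum>i=1..m. (max 0 (K + sum a {1..i}) - max 0 (K + sum a {1..<i})) * z i)"
    using Suc by auto
  have eq: "{1..<Suc m} = {1..m}" by auto
  show ?case
  proof (cases "Suc m \<le> p")
    case True
    then have "(\<Sum>i=1..m. a i * z i) = (\<Sum>i=1..m. a i)" "z (Suc m) = 1"
      using Suc.prems by (auto intro!: sum.cong)
    then show ?thesis using IH eq by simp
  next
    case False
    then have "z (Suc m) = 0" using Suc.prems by auto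
    then show ?thesis using IH by simp
  qed
qed simp

text \<open>Again convexity, now with the smallest base point: by itself, from \<open>K\<close>,
  each asset raises \<open>max 0\<close> by no more than it does on top of the others.\<close>

lemma max_sum_ge_separate:
  fixes K :: real and a z :: "nat \<Rightarrow> real"
  assumes "\<And>i. 1 \<le> i \<Longrightarrow> i \<le> m \<Longrightarrow> a i \<ge> 0 \<and> z i \<in> {0, 1}"
  shows "max 0 K + (\<Sum>i=1..m. (max 0 (K + a i) - max 0 K) * z i) \<le>
    max 0 (K + (\<Sum>i=1..m. a i * z i))"
  using assms
proof (induction m)
  case (Suc m)
  have IH: "max 0 K + (\<Sum>i=1..m. (max 0 (K + a i) - max 0 K) * z i) \<le>
      max 0 (K + (\<Sum>i=1..m. a i * z i))"
    using Suc by auto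
  have "(\<Sum>i=1..m. a i * z i) \<ge> 0"
    by (rule sum_nonneg) (use Suc.prems in force)
  moreover have "a (Suc m) \<ge> 0" "z (Suc m) = 0 \<or> z (Suc m) = 1"
    using Suc.prems[of "Suc m"] by auto
  moreover have step: "r + (max 0 (K + t) - max 0 K) \<le> max 0 (K + (s + t))"
    if "r \<le> max 0 (K + s)" "s \<ge> 0" "t \<ge> 0" for r s t :: real
    using that by (simp add: max_def split: if_splits)
  ultimately show ?case
    using IH step[OF IH] by (elim disjE) (simp_all add: add.assoc del: max_less_iff_conj)
qed simp

text \<open>At most one summand survives. An index \<open>p\<close> outside \<open>{1..m}\<close>
  stands for no up-move at all, which covers \<open>nu m 0\<close>.\<close>

lemma max_sum_eq_separate:
  fixes K :: real and a z :: "nat \<Rightarrow> real"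
  assumes "\<And>i. 1 \<le> i \<Longrightarrow> i \<le> m \<Longrightarrow> z i = of_bool (i = p)"
  shows "max 0 (K + (\<Sum>i=1..m. a i * z i)) =
    max 0 K + (\<Sum>i=1..m. (max 0 (K + a i) - max 0 K) * z i)"
proof -
  have "(\<Sum>i=1..m. g i * z i) = (if p \<in> {1..m} then g p else 0)" for g :: "nat \<Rightarrow> real"
  proof -
    have "(\<Sum>i=1..m. g i * z i) = (\<Sum>i=1..m. if i = p then g i else 0)"
      by (rule sum.cong) (auto simp: assms)
    then show ?thesis by (simp add: sum.delta)
  qed
  then show ?thesis by simp
qed

section \<open>Words and iterated expectations\<close>

lemma finite_scenarios [simp]: "finite (scenarios m)"
  unfolding scenarios_def by (rule finite_PiE) auto

lemma scenarios_cases: "x \<in> scenarios m \<Longrightarrow> i \<in> {1..m} \<Longrightarrow> x i = 0 \<or> x i = 1"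
  by (auto simp: scenarios_def PiE_def Pi_def)

lemma finite_words [simp]: "finite (words m k)"
  unfolding words_def by (rule finite_lists_length_eq) simp

lemma words_0 [simp]: "words m 0 = {[]}"
  by (auto simp: words_def)

lemma Cons_in_words [simp]: "x # w \<in> words m (Suc k) \<longleftrightarrow> x \<in> scenarios m \<and> w \<in> words m k"
  by (auto simp: words_def)

lemma append_in_words: "w \<in> words m j \<Longrightarrow> v \<in> words m k \<Longrightarrow> w @ v \<in> words m (j + k)"
  by (auto simp: words_def)

lemma length_words: "w \<in> words m k \<Longrightarrow> length w = k"
  by (simp add: words_def)

lemma take_in_words: "w \<in> words m k \<Longrightarrow> j \<le> k \<Longrightarrow> take j w \<in> words m j"
  by (auto simp: words_def dest: in_set_takeD)

lemma drop_in_words: "w \<in> words m k \<Longrightarrow> drop j w \<in> words m (k - j)"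
  by (auto simp: words_def dest: in_set_dropD)

lemma scenarios_nonempty: "scenarios m \<noteq> {}"
  by (simp add: scenarios_def PiE_eq_empty_iff)

lemma words_nonempty: "words m k \<noteq> {}"
proof -
  obtain x where "x \<in> scenarios m" using scenarios_nonempty by blast
  then have "replicate k x \<in> words m k" by (auto simp: words_def)
  then show ?thesis by blast
qed

lemma sum_words_Suc:
  "(\<Sum>w\<in>words m (Suc k). f w) = (\<Sum>x\<in>scenarios m. \<Sum>w\<in>words m k. f (x # w))"
proof -
  have "(\<Sum>x\<in>scenarios m. \<Sum>w\<in>words m k. f (x # w))
      = (\<Sum>(x, w)\<in>scenarios m \<times> words m k. f (x # w))"
    by (simp add: sum.cartesian_product)
  also have "\<dots> = (\<Sum>w\<in>words m (Suc k). f w)"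
    by (rule sum.reindex_bij_witness[where i="\<lambda>w. (hd w, tl w)" and j="\<lambda>(x, w). x # w"])
       (auto simp: words_def length_Suc_conv)
  finally show ?thesis by simp
qed

lemma pmf_replicate_Cons:
  "pmf (replicate_pmf (Suc k) q) (x # w) = pmf q x * pmf (replicate_pmf k q) w"
proof -
  \<comment> \<open>Prepending a letter is injective on pairs, so the image law keeps the product
    weights.\<close>
  have "replicate_pmf (Suc k) q = map_pmf (\<lambda>(x, w). x # w) (pair_pmf q (replicate_pmf k q))"
    by (simp add: pair_pmf_def map_pmf_def bind_assoc_pmf bind_return_pmf)
  moreover have "pmf (map_pmf (\<lambda>(x, w). x # w) (pair_pmf q (replicate_pmf k q)))
      ((\<lambda>(x, w). x # w) (x, w)) = pmf (pair_pmf q (replicate_pmf k q)) (x, w)"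
    by (rule pmf_map_inj') (auto simp: inj_def)
  ultimately show ?thesis by (simp add: pmf_pair)
qed

lemma pmf_replicate_append:
  "pmf (replicate_pmf (length v + k) q) (v @ w)
    = pmf (replicate_pmf (length v) q) v * pmf (replicate_pmf k q) w"
  by (induction v) (simp_all add: pmf_replicate_Cons del: replicate_pmf.simps(2))

lemma set_replicate_pmf_subset:
  "set_pmf q \<subseteq> scenarios m \<Longrightarrow> set_pmf (replicate_pmf k q) \<subseteq> words m k"
  by (auto simp: set_replicate_pmf words_def)

lemma expectation_finite_sum:
  fixes f :: "'a \<Rightarrow> real"
  assumes "finite A" "set_pmf p \<subseteq> A"
  shows "measure_pmf.expectation p f = (\<Sum>x\<in>A. pmf p x * f x)"
  using assms by (subst integral_measure_pmf[of A]) auto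

lemma expectation_replicate_Suc:
  fixes f :: "(nat \<Rightarrow> nat) list \<Rightarrow> real"
  assumes "set_pmf q \<subseteq> scenarios m"
  shows "measure_pmf.expectation (replicate_pmf (Suc k) q) f
    = measure_pmf.expectation q (\<lambda>x. measure_pmf.expectation (replicate_pmf k q) (\<lambda>w. f (x # w)))"
  by (simp add: expectation_finite_sum[OF _ set_replicate_pmf_subset[OF assms]]
      expectation_finite_sum[OF _ assms] sum_words_Suc pmf_replicate_Cons sum_distrib_left
      mult.assoc del: replicate_pmf.simps(2))

section \<open>Convex combinations of laws, and densities with finite support\<close>

definition mixture :: "real \<Rightarrow> 'a pmf \<Rightarrow> 'a pmf \<Rightarrow> 'a pmf" where
  "mixture e p q = bind_pmf (bernoulli_pmf e) (\<lambda>c. if c then p else q)"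

lemma pmf_mixture:
  assumes "0 \<le> e" "e \<le> 1"
  shows "pmf (mixture e p q) x = e * pmf p x + (1 - e) * pmf q x"
  using assms by (simp add: mixture_def pmf_bind)

lemma set_mixture_subset: "set_pmf (mixture e p q) \<subseteq> set_pmf p \<union> set_pmf q"
  by (auto simp: mixture_def split: if_splits)

text \<open>The weight of a word is a finite product of letter weights, each of which converges as
  the share of \<open>p\<close> tends to 0.\<close>

lemma tendsto_pmf_replicate_mixture:
  "(\<lambda>j. pmf (replicate_pmf (length w) (mixture (1 / real (Suc j)) p q)) w)
     \<longlonglongrightarrow> pmf (replicate_pmf (length w) q) w"
proof (induction w)
  case (Cons x w)
  have "(\<lambda>j. 1 / real (Suc j) * pmf p x + (1 - 1 / real (Suc j)) * pmf q x)
      \<longlonglongrightarrow> 0 * pmf p x + (1 - 0) * pmf q x"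
    by (intro tendsto_intros LIMSEQ_Suc[OF lim_1_over_n])
  then have "(\<lambda>j. pmf (mixture (1 / real (Suc j)) p q) x) \<longlonglongrightarrow> pmf q x"
    by (subst pmf_mixture) (simp_all add: field_simps)
  from tendsto_mult[OF this Cons.IH] show ?case
    by (simp add: pmf_replicate_Cons del: replicate_pmf.simps(2))
qed simp

text \<open>This gives access to \<open>embed_pmf\<close>, which is specified only for nonnegative
  functions of total mass 1. Sums are organised by the index \<open>i\<close>, so that weights of
  coinciding points \<open>x i\<close> add up.\<close>

lemma embed_pmf_indicator_sum:
  fixes c :: "'i \<Rightarrow> real" and g :: "'a \<Rightarrow> real" and x :: "'i \<Rightarrow> 'a"
  assumes fin: "finite I" and c: "\<And>i. i \<in> I \<Longrightarrow> c i \<ge> 0" "sum c I = 1"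
  defines "q \<equiv> embed_pmf (\<lambda>y. \<Sum>i\<in>I. c i * indicator {x i} y)"
  shows "set_pmf q \<subseteq> x ` I" and "measure_pmf.expectation q g = (\<Sum>i\<in>I. c i * g (x i))"
proof -
  let ?d = "\<lambda>y. \<Sum>i\<in>I. c i * indicator {x i} y :: real"
  have nn: "?d y \<ge> 0" for y using c by (auto intro!: sum_nonneg)
  have sum: "(\<Sum>y\<in>x ` I. ?d y * h y) = (\<Sum>i\<in>I. c i * h (x i))" for h
  proof -
    have "(\<Sum>y\<in>x ` I. ?d y * h y) = (\<Sum>i\<in>I. \<Sum>y\<in>x ` I. c i * indicator {x i} y * h y)"
      unfolding sum_distrib_right by (rule sum.swap)
    also have "\<dots> = (\<Sum>i\<in>I. c i * h (x i))"
    proof (rule sum.cong[OF refl])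
      fix i assume "i \<in> I"
      have "(\<Sum>y\<in>x ` I. c i * indicator {x i} y * h y)
          = (\<Sum>y\<in>x ` I. if y = x i then c i * h y else 0)"
        by (rule sum.cong) (auto simp: indicator_def)
      then show "(\<Sum>y\<in>x ` I. c i * indicator {x i} y * h y) = c i * h (x i)"
        using fin \<open>i \<in> I\<close> by (simp add: sum.delta)
    qed
    finally show ?thesis .
  qed
  have out: "?d y = 0" if "y \<notin> x ` I" for y
    using that by (intro sum.neutral) (auto simp: indicator_def)
  have "(\<integral>\<^sup>+y. ennreal (?d y) \<partial>count_space UNIV) = (\<Sum>y\<in>x ` I. ennreal (?d y))"
    using fin out by (intro nn_integral_count_space'[where A="x ` I"]) auto
  also have "\<dots> = 1"
    using sum[of "\<lambda>_. 1"] c nn by (simp add: sum_ennreal)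
  finally have pmf: "pmf q y = ?d y" for y
    unfolding q_def using nn by (intro pmf_embed_pmf) auto
  show "set_pmf q \<subseteq> x ` I"
    using out by (force simp: set_pmf_iff pmf)
  then show "measure_pmf.expectation q g = (\<Sum>i\<in>I. c i * g (x i))"
    using fin sum by (simp add: expectation_finite_sum[of "x ` I"] pmf)
qed

section \<open>The multinomial formula\<close>

lemma finite_compositions [simp]: "finite (compositions m k)"
proof (rule finite_subset)
  show "compositions m k \<subseteq> {0..m} \<rightarrow>\<^sub>E {0..k}"
    by (auto simp: compositions_def PiE_def Pi_def intro: member_le_sum)
qed (auto intro: finite_PiE)

lemma mset_block_word: "mset (block_word m x a) = (\<Sum>j=0..m. replicate_mset (a j) (x j))"
  by (induction m) (simp_all add: block_word_def)

lemma sum_fun_upd_Suc: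
  fixes a :: "'i \<Rightarrow> nat"
  assumes "finite I" "j \<in> I"
  shows "sum (a(j := Suc (a j))) I = Suc (sum a I)"
  using assms by (subst (1 2) sum.remove[where x=j]) (auto intro!: sum.cong)

lemma mset_block_word_upd:
  assumes "j \<le> m"
  shows "mset (block_word m x (a(j := Suc (a j)))) = add_mset (x j) (mset (block_word m x a))"
  using assms unfolding mset_block_word
  by (subst (1 2) sum.remove[where x=j]) (auto intro!: sum.cong)

definition multinomial_weight :: "nat \<Rightarrow> (nat \<Rightarrow> real) \<Rightarrow> nat \<Rightarrow> (nat \<Rightarrow> nat) \<Rightarrow> real" where
  "multinomial_weight m c k a = fact k / (\<Prod>j=0..m. fact (a j)) * (\<Prod>j=0..m. c j ^ a j)"

text \<open>Only the factors at \<open>j\<close> and the leading factorial change: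
  \<open>k! = (k+1)!/(k+1)\<close> and \<open>1/a! = (a+1)/(a+1)!\<close>.\<close>

lemma multinomial_weight_upd:
  assumes "j \<le> m"
  shows "c j * multinomial_weight m c k a
    = real (Suc (a j)) / real (Suc k) * multinomial_weight m c (Suc k) (a(j := Suc (a j)))"
proof -
  define A where "A = {0..m} - {j}"
  have ins: "(\<Prod>i=0..m. g i) = g j * (\<Prod>i\<in>A. g i)" for g :: "nat \<Rightarrow> real"
    unfolding A_def using assms by (subst prod.remove[where x=j]) auto
  have "(\<Prod>i\<in>A. fact ((a(j := Suc (a j))) i)) = (\<Prod>i\<in>A. fact (a i) :: real)"
    "(\<Prod>i\<in>A. c i ^ ((a(j := Suc (a j))) i)) = (\<Prod>i\<in>A. c i ^ a i)"
    by (auto intro!: prod.cong simp: A_def)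
  then show ?thesis
    unfolding multinomial_weight_def ins by (simp add: divide_simps)
qed

text \<open>Raising the entry at \<open>j\<close> is a bijection from the compositions of
  \<open>k\<close> onto those of \<open>k + 1\<close> with a positive entry at
  \<open>j\<close>.\<close>

lemma sum_compositions_upd:
  assumes "j \<le> m"
  shows "(\<Sum>a\<in>compositions m k. c j * multinomial_weight m c k a * h (a(j := Suc (a j))))
    = (\<Sum>a\<in>compositions m (Suc k).
         real (a j) / real (Suc k) * multinomial_weight m c (Suc k) a * h a)"
proof -
  have "(\<Sum>a\<in>compositions m k. c j * multinomial_weight m c k a * h (a(j := Suc (a j))))
    = (\<Sum>a\<in>{a\<in>compositions m (Suc k). a j > 0}.
         real (a j) / real (Suc k) * multinomial_weight m c (Suc k) a * h a)"
  proof (rule sum.reindex_bij_witness[where i="\<lambda>a. a(j := a j - 1)" and j="\<lambda>a. a(j := Suc (a j))"])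
    fix a assume "a \<in> {a \<in> compositions m (Suc k). a j > 0}"
    moreover have "sum ((a(j := a j - 1))(j := Suc (a j - 1))) {0..m} = Suc (sum (a(j := a j - 1)) {0..m})"
      using sum_fun_upd_Suc[of "{0..m}" j "a(j := a j - 1)"] assms by simp
    ultimately show "a(j := a j - 1) \<in> compositions m k"
      using assms by (auto simp: compositions_def PiE_def extensional_def)
  next
    fix a assume "a \<in> compositions m k"
    then show "a(j := Suc (a j)) \<in> {a \<in> compositions m (Suc k). a j > 0}"
      using assms sum_fun_upd_Suc[of "{0..m}" j a]
      by (auto simp: compositions_def PiE_def extensional_def)
  next
    fix a
    show "real ((a(j := Suc (a j))) j) / real (Suc k) *
        multinomial_weight m c (Suc k) (a(j := Suc (a j))) * h (a(j := Suc (a j)))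
      = c j * multinomial_weight m c k a * h (a(j := Suc (a j)))"
      using multinomial_weight_upd[OF assms, of c k a] by simp
  qed auto
  also have "\<dots> = (\<Sum>a\<in>compositions m (Suc k).
      real (a j) / real (Suc k) * multinomial_weight m c (Suc k) a * h a)"
    \<comment> \<open>Compositions with \<open>a j = 0\<close> may be added, since their factor
      \<open>a j\<close> vanishes.\<close>
    by (rule sum.mono_neutral_left) auto
  finally show ?thesis .
qed

text \<open>Induction by splitting off the first letter: by symmetry of \<open>f\<close> the letter
  \<open>x j\<close> can be moved into its block, which turns a composition of \<open>k\<close> into
  one of \<open>k + 1\<close>.\<close>

lemma expectation_replicate_multinomial:
  fixes f :: "(nat \<Rightarrow> nat) list \<Rightarrow> real"
  assumes q: "set_pmf q \<subseteq> scenarios M"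
    and E: "\<And>g. measure_pmf.expectation q g = (\<Sum>j=0..m. c j * g (x j))"
    and f: "\<And>v w. mset v = mset w \<Longrightarrow> f v = f w"
  shows "measure_pmf.expectation (replicate_pmf k q) f
    = (\<Sum>a\<in>compositions m k. multinomial_weight m c k a * f (block_word m x a))"
  using f
proof (induction k arbitrary: f)
  case 0
  have *: "compositions m 0 = {\<lambda>_\<in>{0..m}. 0}"
    by (fastforce simp: compositions_def PiE_def extensional_def)
  have "mset (block_word m x (\<lambda>_\<in>{0..m}. 0)) = mset []"
    by (simp add: mset_block_word)
  then have "f (block_word m x (\<lambda>_\<in>{0..m}. 0)) = f []"
    by (rule 0)
  moreover have "multinomial_weight m c 0 (\<lambda>_\<in>{0..m}. 0) = 1"
    by (simp add: multinomial_weight_def)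
  ultimately show ?case
    unfolding * by (simp del: restrict_apply)
next
  case (Suc k)
  have "measure_pmf.expectation (replicate_pmf (Suc k) q) f
      = (\<Sum>j=0..m. c j * measure_pmf.expectation (replicate_pmf k q) (\<lambda>w. f (x j # w)))"
    unfolding expectation_replicate_Suc[OF q] E ..
  also have "\<dots> = (\<Sum>j=0..m. \<Sum>a\<in>compositions m (Suc k).
      real (a j) / real (Suc k) * multinomial_weight m c (Suc k) a * f (block_word m x a))"
  proof (rule sum.cong[OF refl])
    fix j assume j: "j \<in> {0..m}"
    have "measure_pmf.expectation (replicate_pmf k q) (\<lambda>w. f (x j # w))
        = (\<Sum>a\<in>compositions m k. multinomial_weight m c k a * f (x j # block_word m x a))"
      by (rule Suc.IH) (auto intro: Suc.prems)
    also have "\<dots> = (\<Sum>a\<in>compositions m k.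
        multinomial_weight m c k a * f (block_word m x (a(j := Suc (a j)))))"
      using j by (intro sum.cong arg_cong2[where f="(*)"] refl Suc.prems)
        (simp add: mset_block_word_upd)
    finally have "c j * measure_pmf.expectation (replicate_pmf k q) (\<lambda>w. f (x j # w))
        = (\<Sum>a\<in>compositions m k. c j * multinomial_weight m c k a
            * f (block_word m x (a(j := Suc (a j)))))"
      by (simp add: sum_distrib_left mult.assoc)
    also have "\<dots> = (\<Sum>a\<in>compositions m (Suc k).
        real (a j) / real (Suc k) * multinomial_weight m c (Suc k) a * f (block_word m x a))"
      using j by (intro sum_compositions_upd[where h="\<lambda>a. f (block_word m x a)"]) simp
    finally show "c j * measure_pmf.expectation (replicate_pmf k q) (\<lambda>w. f (x j # w)) = \<dots>" .
  qed
  also have "\<dots> = (\<Sum>a\<in>compositions m (Suc k).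
      multinomial_weight m c (Suc k) a * f (block_word m x a))"
  \<comment> \<open>For a fixed composition of \<open>k + 1\<close> the shares
    \<open>a j / (k + 1)\<close> of the possible first letters add up to 1.\<close>
  proof (subst sum.swap, rule sum.cong[OF refl])
    fix a assume "a \<in> compositions m (Suc k)"
    then have "(\<Sum>j=0..m. real (a j)) = real (Suc k)"
      unfolding compositions_def of_nat_sum[symmetric] by simp
    then have "(\<Sum>j=0..m. real (a j) / real (Suc k)) = 1"
      unfolding sum_divide_distrib[symmetric] by simp
    then show "(\<Sum>j=0..m. real (a j) / real (Suc k) * multinomial_weight m c (Suc k) a
        * f (block_word m x a)) = multinomial_weight m c (Suc k) a * f (block_word m x a)"
      unfolding sum_distrib_right[symmetric] by simp
  qed
  finally show ?case .
qed

section \<open>Risk-neutral measures\<close>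

locale binomial_model =
  fixes m n :: nat and R :: real and D U S0 :: "nat \<Rightarrow> real"
  assumes assets: "1 \<le> m" \<comment> \<open>for \<open>m = 0\<close> the event \<^const>\<open>history_event\<close> is \<^const>\<open>UNIV\<close>\<close>
    and model: "\<And>i. i \<in> {1..m} \<Longrightarrow> 0 < D i \<and> D i < R \<and> R < U i \<and> 0 < S0 i"
begin

text \<open>The one-step risk-neutral probability of an up-move: the solution \<open>p\<close> of
  \<open>p * U i + (1 - p) * D i = R\<close>.\<close>

definition up_prob :: "nat \<Rightarrow> real" where
  "up_prob i = (R - D i) / (U i - D i)"

definition move :: "nat \<Rightarrow> (nat \<Rightarrow> nat) \<Rightarrow> real" where
  "move i x = (if x i = 0 then U i else D i)"

text \<open>The price relative to its initial value, as a product over letters: multiplicative under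
  concatenation and invariant under permutations, which the exponents in \<open>stock\<close> do not
  display.\<close>

definition walk :: "nat \<Rightarrow> (nat \<Rightarrow> nat) list \<Rightarrow> real" where
  "walk i w = prod_list (map (move i) w)"

definition up :: "nat \<Rightarrow> (nat \<Rightarrow> nat) \<Rightarrow> real" where
  "up i x = of_bool (x i = 0)"

abbreviation "S \<equiv> stock S0 D U"
abbreviation "\<Gamma> \<equiv> risk_neutral_measures m n R S0 D U"
abbreviation "history \<equiv> history_event m n S0 D U"

section \<open>Price factors, and histories of prices as prefixes of words\<close>

lemma up_prob_bounds: "i \<in> {1..m} \<Longrightarrow> 0 < up_prob i \<and> up_prob i < 1"
  using model[of i] by (auto simp: up_prob_def)

lemma move_eq: "move i x = D i + (U i - D i) * up i x"
  by (simp add: move_def up_def)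

lemma move_pos: "i \<in> {1..m} \<Longrightarrow> move i x > 0"
  using model[of i] by (auto simp: move_def)

lemma walk_simps [simp]:
  "walk i [] = 1" "walk i (x # w) = move i x * walk i w" "walk i (v @ w) = walk i v * walk i w"
  by (simp_all add: walk_def)

lemma walk_pos: "i \<in> {1..m} \<Longrightarrow> walk i w > 0"
  by (induction w) (simp_all add: move_pos)

lemma stock_eq_walk:
  assumes "set w \<subseteq> scenarios m" "i \<in> {1..m}" "k \<le> length w"
  shows "S i k w = S0 i * walk i (take k w)"
  using assms(3)
proof (induction k)
  case 0
  then show ?case by (simp add: stock_def)
next
  case (Suc k)
  let ?s = "\<Sum>j<k. (w ! j) i"
  have letter: "(w ! j) i = 0 \<or> (w ! j) i = 1" if "j < length w" for j
    using scenarios_cases[of "w ! j" m i] nth_mem[OF that] assms(1,2) by blast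
  \<comment> \<open>The exponent \<open>k - ?s\<close> is a truncated difference; it counts the
    up-moves because each letter contributes at most 1.\<close>
  have "?s \<le> of_nat (card {..<k}) * 1"
    using letter Suc.prems by (intro sum_bounded_above) (metis Suc_le_lessD lessThan_iff le_eq_less_or_eq less_trans zero_le)
  then have le: "?s \<le> k" by simp
  have "S0 i * D i ^ ?s * U i ^ (k - ?s) * move i (w ! k) = S i (Suc k) w"
    using letter[of k] Suc.prems le by (auto simp: stock_def move_def Suc_diff_le)
  moreover have "S0 i * D i ^ ?s * U i ^ (k - ?s) = S0 i * walk i (take k w)"
    using Suc by (simp add: stock_def)
  moreover have "take (Suc k) w = take k w @ [w ! k]"
    using Suc.prems by (simp add: take_Suc_conv_app_nth)
  ultimately show ?case by simp
qed

text \<open>Prices reveal the path: the ratio of consecutive prices of asset \<open>i\<close> is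
  \<open>U i\<close> or \<open>D i\<close>, and these differ.\<close>

lemma take_eq_if_stock_eq:
  assumes "v \<in> words m n" "w \<in> words m n" "k \<le> n"
    and "\<And>t i. t \<le> k \<Longrightarrow> i \<in> {1..m} \<Longrightarrow> S i t v = S i t w"
  shows "take k v = take k w"
  using assms(3,4)
proof (induction k)
  case (Suc k)
  have IH: "take k v = take k w" using Suc by simp
  have len: "length v = n" "length w = n" and sets: "set v \<subseteq> scenarios m" "set w \<subseteq> scenarios m"
    using assms by (auto simp: words_def)
  have tk: "take (Suc k) v = take k w @ [v ! k]" "take (Suc k) w = take k w @ [w ! k]"
    using len Suc.prems IH by (simp_all add: take_Suc_conv_app_nth)
  have mem: "v ! k \<in> scenarios m" "w ! k \<in> scenarios m"
    using sets len Suc.prems by auto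
  have "v ! k = w ! k"
  proof (rule PiE_ext[OF mem[unfolded scenarios_def]])
    fix i assume i: "i \<in> {1..m}"
    have "S0 i * walk i (take (Suc k) v) = S0 i * walk i (take (Suc k) w)"
      using Suc.prems i len sets by (simp flip: stock_eq_walk)
    then have "move i (v ! k) = move i (w ! k)"
      using model[OF i] walk_pos[OF i, of "take k w"] by (simp add: tk)
    then show "(v ! k) i = (w ! k) i"
      using model[OF i] scenarios_cases[OF mem(1) i] scenarios_cases[OF mem(2) i]
      by (auto simp: move_def split: if_splits)
  qed
  then show ?case by (simp add: tk)
qed simp

text \<open>The prices up to time \<open>k\<close> and the first \<open>k\<close> letters determine
  each other, so conditioning on the history is conditioning on a prefix.\<close>

lemma history_eq:
  assumes "w \<in> words m n" "k \<le> n"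
  shows "history k w = (\<lambda>v. take k w @ v) ` words m (n - k)"
proof (intro set_eqI iffI)
  fix v assume v: "v \<in> history k w"
  then have "v \<in> words m n" and "\<And>t i. t \<le> k \<Longrightarrow> i \<in> {1..m} \<Longrightarrow> S i t v = S i t w"
    using assets by (fastforce simp: history_event_def)+
  then have "v \<in> words m n" "take k v = take k w"
    using take_eq_if_stock_eq[of v w k] assms by blast+
  then show "v \<in> (\<lambda>v. take k w @ v) ` words m (n - k)"
    using drop_in_words[of v m n k] append_take_drop_id[of k v] by (metis image_eqI)
next
  fix v assume "v \<in> (\<lambda>v. take k w @ v) ` words m (n - k)"
  then obtain u where u: "u \<in> words m (n - k)" "v = take k w @ u" by auto
  then have v: "v \<in> words m n"
    using append_in_words[OF take_in_words[OF assms] u(1)] assms by simp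
  have "S i t v = S i t w" if "t \<le> k" "i \<in> {1..m}" for t i
  proof -
    have "take t v = take t w"
      using that u assms by (simp add: words_def min_absorb1)
    then show ?thesis
      using that v assms by (simp add: words_def stock_eq_walk)
  qed
  then show "v \<in> history k w"
    using v by (auto simp: history_event_def)
qed

section \<open>Unnormalised conditional expectations over the words with a given prefix\<close>

definition tail_sum ::
  "(nat \<Rightarrow> nat) list pmf \<Rightarrow> ((nat \<Rightarrow> nat) list \<Rightarrow> real) \<Rightarrow> (nat \<Rightarrow> nat) list \<Rightarrow> real" where
  "tail_sum P X v = (\<Sum>w\<in>words m (n - length v). pmf P (v @ w) * X (v @ w))"

abbreviation mass :: "(nat \<Rightarrow> nat) list pmf \<Rightarrow> (nat \<Rightarrow> nat) list \<Rightarrow> real" where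
  "mass P v \<equiv> tail_sum P (\<lambda>_. 1) v"

lemma tail_sum_step:
  assumes "length v < n"
  shows "tail_sum P X v = (\<Sum>x\<in>scenarios m. tail_sum P X (v @ [x]))"
proof -
  have "n - length v = Suc (n - Suc (length v))" using assms by simp
  then show ?thesis by (simp add: tail_sum_def sum_words_Suc)
qed

lemma mass_nonneg: "mass P v \<ge> 0"
  by (simp add: tail_sum_def sum_nonneg)

lemma mass_pos:
  assumes "\<And>w. w \<in> words m n \<Longrightarrow> pmf P w > 0" "v \<in> words m k" "k \<le> n"
  shows "mass P v > 0"
  unfolding tail_sum_def
  using assms(1,3) words_nonempty append_in_words[OF assms(2), of _ "n - k"] length_words[OF assms(2)]
  by (intro sum_pos) simp_all

lemma cond_expectation_eq:
  assumes P: "set_pmf P \<subseteq> words m n" "\<And>w. w \<in> words m n \<Longrightarrow> pmf P w > 0"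
    and w: "w \<in> words m n" "k \<le> n"
  shows "cond_expectation P X (history k w) = tail_sum P X (take k w) / mass P (take k w)"
proof -
  let ?A = "history k w"
  have "?A \<subseteq> words m n" using assets by (fastforce simp: history_event_def)
  then have A: "?A \<subseteq> words m n" "finite ?A" "w \<in> ?A"
    using w by (auto simp: history_event_def intro: finite_subset[OF _ finite_words])
  \<comment> \<open>The event contains \<open>w\<close>, which has positive weight, so
    \<open>cond_pmf\<close> is the genuine conditional law.\<close>
  then have ne: "set_pmf P \<inter> ?A \<noteq> {}"
    using P(2)[OF w(1)] by (auto simp: pmf_positive_iff)
  have sum: "(\<Sum>v\<in>?A. f v) = (\<Sum>v\<in>words m (n - length (take k w)). f (take k w @ v))"
    for f :: "(nat \<Rightarrow> nat) list \<Rightarrow> real"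
    using w unfolding history_eq[OF w] by (subst sum.reindex) (auto simp: inj_on_def words_def)
  have "cond_expectation P X ?A = (\<Sum>v\<in>?A. pmf (cond_pmf P ?A) v * X v)"
    unfolding cond_expectation_def using A ne by (intro expectation_finite_sum) auto
  also have "\<dots> = (\<Sum>v\<in>?A. pmf P v * X v) / (\<Sum>v\<in>?A. pmf P v)"
    using A by (simp add: pmf_cond[OF ne] measure_measure_pmf_finite sum_divide_distrib)
  finally show ?thesis
    by (simp add: sum tail_sum_def)
qed

lemma risk_neutralD:
  assumes "P \<in> \<Gamma>"
  shows "set_pmf P \<subseteq> words m n" "\<And>w. w \<in> words m n \<Longrightarrow> pmf P w > 0"
    "\<And>i w k l. i \<in> {1..m} \<Longrightarrow> w \<in> words m n \<Longrightarrow> k + l \<le> n \<Longrightarrow>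
      cond_expectation P (S i (k + l)) (history k w) = R ^ l * S i k w"
  using assms unfolding risk_neutral_measures_def by blast+

text \<open>Risk neutrality with \<open>l = 1\<close> says that, given the prefix, the next price
  factor has mean \<open>R\<close>. That factor is affine in the up-indicator, so its mean fixes the
  up-probability.\<close>

lemma risk_neutral_up_prob:
  assumes P: "P \<in> \<Gamma>" and v: "v \<in> words m j" "j < n" and i: "i \<in> {1..m}"
  shows "(\<Sum>x\<in>scenarios m. mass P (v @ [x]) * up i x) = up_prob i * mass P v"
proof -
  \<comment> \<open>Histories are indexed by full words; any continuation of \<open>v\<close> will
    do, as only the prefix enters.\<close>
  obtain u where u: "u \<in> words m (n - j)" using words_nonempty by blast
  define w where "w = v @ u"
  have w: "w \<in> words m n" using append_in_words[OF v(1) u] v by (simp add: w_def)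
  have tk: "take j w = v" and len: "length v = j" using v by (simp_all add: w_def words_def)
  have pos: "mass P v > 0" using mass_pos[OF risk_neutralD(2)[OF P] v(1)] v by simp
  have "tail_sum P (S i (Suc j)) v / mass P v = R * S i j w"
    using risk_neutralD(3)[OF P i w, of j 1] v
      cond_expectation_eq[OF risk_neutralD(1,2)[OF P] w, of j] tk by simp
  moreover have "S i j w = S0 i * walk i v"
    using stock_eq_walk[of w i j] w i v tk by (simp add: words_def)
  moreover have "tail_sum P (S i (Suc j)) v
      = S0 i * walk i v * (\<Sum>x\<in>scenarios m. mass P (v @ [x]) * move i x)"
  proof -
    \<comment> \<open>The price at time \<open>Suc j\<close> depends only on \<open>v\<close> and
      \<open>x\<close>, so it comes out of the sum over the remaining letters.\<close>
    have "tail_sum P (S i (Suc j)) (v @ [x]) = S0 i * walk i v * (mass P (v @ [x]) * move i x)"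
      if x: "x \<in> scenarios m" for x
    proof -
      have "S i (Suc j) (v @ x # u) = S0 i * walk i v * move i x"
        if "u \<in> words m (n - Suc j)" for u
        using that v x i by (subst stock_eq_walk) (auto simp: words_def)
      then show ?thesis
        using len by (simp add: tail_sum_def sum_distrib_left sum_distrib_right mult_ac)
    qed
    then show ?thesis
      using tail_sum_step[of v] v len by (simp add: sum_distrib_left)
  qed
  ultimately have "(\<Sum>x\<in>scenarios m. mass P (v @ [x]) * move i x) = R * mass P v"
    using pos model[OF i] walk_pos[OF i, of v] by (simp add: field_simps)
  moreover have "(\<Sum>x\<in>scenarios m. mass P (v @ [x]) * move i x)
      = D i * mass P v + (U i - D i) * (\<Sum>x\<in>scenarios m. mass P (v @ [x]) * up i x)"
    using tail_sum_step[of v P "\<lambda>_. 1"] v len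
    by (simp add: move_eq algebra_simps sum.distrib sum_subtractf sum_distrib_left)
  ultimately show ?thesis
    using model[OF i] by (simp add: up_prob_def field_simps)
qed

text \<open>Only the marginals are prescribed; the dependence between the assets remains free. Full
  support is left out, so that the extremal densities are included.\<close>

definition one_step :: "(nat \<Rightarrow> nat) pmf \<Rightarrow> bool" where
  "one_step q \<longleftrightarrow> set_pmf q \<subseteq> scenarios m \<and>
     (\<forall>i\<in>{1..m}. measure_pmf.expectation q (up i) = up_prob i)"

lemma one_step_sum:
  assumes "one_step q"
  shows "set_pmf q \<subseteq> scenarios m"
    and "(\<Sum>x\<in>scenarios m. pmf q x) = 1"
    and "i \<in> {1..m} \<Longrightarrow> (\<Sum>x\<in>scenarios m. pmf q x * up i x) = up_prob i"
  using assms expectation_finite_sum[OF finite_scenarios, of q]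
  by (auto simp: one_step_def sum_pmf_eq_1)

text \<open>
  One-step optimality of \<open>q\<close>: all one-step laws with the prescribed marginals give the affine
  majorant the same expectation, and under \<open>q\<close> this is the expectation of \<open>G\<close> itself. The letters
  \<open>w\<close> to the right are fixed as well because the induction averages over them independently of
  the current letter.
\<close>
definition affine_majorized :: "(nat \<Rightarrow> nat) pmf \<Rightarrow> ((nat \<Rightarrow> nat) list \<Rightarrow> real) \<Rightarrow> bool" where
  "affine_majorized q G \<longleftrightarrow>
    (\<forall>v w. v @ w \<in> words m (n - 1) \<longrightarrow>
      (\<exists>\<alpha> \<beta>. (\<forall>x\<in>scenarios m. G (v @ x # w) \<le> \<alpha> + (\<Sum>i=1..m. \<beta> i * up i x)) \<and>
             (\<forall>x\<in>set_pmf q. G (v @ x # w) = \<alpha> + (\<Sum>i=1..m. \<beta> i * up i x))))"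

text \<open>Pass to the affine majorant, exchange the conditional law under \<open>P\<close> for
  \<open>q\<close>, which has the same marginals, and return to \<open>G\<close>, which meets the
  majorant on the support of \<open>q\<close>.\<close>

lemma majorized_step:
  assumes q: "one_step q" "affine_majorized q G" and vw: "v @ w \<in> words m (n - 1)"
    and P: "P \<in> \<Gamma>" and v: "v \<in> words m j" "j < n"
  shows "(\<Sum>x\<in>scenarios m. mass P (v @ [x]) * G (v @ x # w))
    \<le> mass P v * (\<Sum>x\<in>scenarios m. pmf q x * G (v @ x # w))"
proof -
  obtain \<alpha> \<beta> where ab: "\<And>x. x \<in> scenarios m \<Longrightarrow> G (v @ x # w) \<le> \<alpha> + (\<Sum>i=1..m. \<beta> i * up i x)"
    "\<And>x. x \<in> set_pmf q \<Longrightarrow> G (v @ x # w) = \<alpha> + (\<Sum>i=1..m. \<beta> i * up i x)"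
    using q(2) vw unfolding affine_majorized_def by blast
  \<comment> \<open>A weighted sum of an affine function sees the weights \<open>c\<close> only
    through their total and their up-weights.\<close>
  have affine: "(\<Sum>x\<in>scenarios m. c x * (\<alpha> + (\<Sum>i=1..m. \<beta> i * up i x)))
      = \<alpha> * (\<Sum>x\<in>scenarios m. c x) + (\<Sum>i=1..m. \<beta> i * (\<Sum>x\<in>scenarios m. c x * up i x))" for c
  proof -
    have "(\<Sum>x\<in>scenarios m. c x * (\<Sum>i=1..m. \<beta> i * up i x))
        = (\<Sum>i=1..m. \<beta> i * (\<Sum>x\<in>scenarios m. c x * up i x))"
      unfolding sum_distrib_left by (subst sum.swap) (simp add: mult_ac)
    then show ?thesis
      by (simp add: distrib_left sum.distrib sum_distrib_left mult.commute)
  qed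
  have "(\<Sum>x\<in>scenarios m. mass P (v @ [x]) * G (v @ x # w))
      \<le> (\<Sum>x\<in>scenarios m. mass P (v @ [x]) * (\<alpha> + (\<Sum>i=1..m. \<beta> i * up i x)))"
    by (intro sum_mono mult_left_mono ab mass_nonneg)
  also have "\<dots> = mass P v * (\<alpha> + (\<Sum>i=1..m. \<beta> i * up_prob i))"
  proof -
    have "(\<Sum>x\<in>scenarios m. mass P (v @ [x])) = mass P v"
      using v length_words[OF v(1)] tail_sum_step[of v P "\<lambda>_. 1"] by simp
    moreover have "(\<Sum>i=1..m. \<beta> i * (\<Sum>x\<in>scenarios m. mass P (v @ [x]) * up i x))
        = mass P v * (\<Sum>i=1..m. \<beta> i * up_prob i)"
      unfolding sum_distrib_left
      by (rule sum.cong) (simp_all add: risk_neutral_up_prob[OF P v] flip: sum_distrib_left)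
    ultimately show ?thesis
      unfolding affine by (simp add: distrib_left mult.commute)
  qed
  also have "\<alpha> + (\<Sum>i=1..m. \<beta> i * up_prob i)
      = (\<Sum>x\<in>scenarios m. pmf q x * (\<alpha> + (\<Sum>i=1..m. \<beta> i * up i x)))"
    unfolding affine by (simp add: one_step_sum[OF q(1)])
  also have "\<dots> = (\<Sum>x\<in>scenarios m. pmf q x * G (v @ x # w))"
  proof (rule sum.cong[OF refl])
    fix x
    show "pmf q x * (\<alpha> + (\<Sum>i=1..m. \<beta> i * up i x)) = pmf q x * G (v @ x # w)"
      using ab(2)[of x] by (cases "x \<in> set_pmf q") (simp_all add: set_pmf_iff)
  qed
  finally show ?thesis .
qed

text \<open>Backward induction on the number \<open>k\<close> of letters still to come. The
  unnormalised form avoids dividing by the mass of the prefix.\<close>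

lemma tail_sum_le_product_expectation:
  assumes q: "one_step q" "affine_majorized q G" and P: "P \<in> \<Gamma>"
    and v: "v \<in> words m j" "j + k = n"
  shows "tail_sum P G v \<le> mass P v * measure_pmf.expectation (replicate_pmf k q) (\<lambda>w. G (v @ w))"
  using v
proof (induction k arbitrary: v j)
  case 0
  then show ?case by (simp add: tail_sum_def words_def)
next
  case (Suc k)
  note E = expectation_finite_sum[OF finite_words set_replicate_pmf_subset[OF one_step_sum(1)[OF q(1)]]]
  have j: "j < n" using Suc.prems by simp
  have "tail_sum P G v = (\<Sum>x\<in>scenarios m. tail_sum P G (v @ [x]))"
    using Suc.prems j by (intro tail_sum_step) (simp add: words_def)
  also have "\<dots> \<le> (\<Sum>x\<in>scenarios m. mass P (v @ [x])
      * measure_pmf.expectation (replicate_pmf k q) (\<lambda>w. G ((v @ [x]) @ w)))"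
    using Suc.prems by (intro sum_mono Suc.IH[where j="Suc j"]) (auto simp: words_def)
  \<comment> \<open>After the induction hypothesis the later letters have the same law for every
    \<open>x\<close>, so the sums can be exchanged and the current letter treated with
    \<open>w\<close> fixed.\<close>
  also have "\<dots> = (\<Sum>w\<in>words m k. pmf (replicate_pmf k q) w
      * (\<Sum>x\<in>scenarios m. mass P (v @ [x]) * G (v @ x # w)))"
    unfolding E sum_distrib_left by (subst sum.swap) (simp add: mult_ac)
  also have "\<dots> \<le> (\<Sum>w\<in>words m k. pmf (replicate_pmf k q) w
      * (mass P v * (\<Sum>x\<in>scenarios m. pmf q x * G (v @ x # w))))"
    using Suc.prems j
    by (intro sum_mono mult_left_mono majorized_step[OF q _ P]) (auto simp: words_def)
  also have "\<dots> = mass P v * measure_pmf.expectation (replicate_pmf (Suc k) q) (\<lambda>w. G (v @ w))"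
    unfolding E sum_words_Suc pmf_replicate_Cons sum_distrib_left
    by (subst sum.swap) (simp add: mult_ac)
  finally show ?case .
qed

section \<open>Risk-neutral product measures\<close>

lemma cond_expectation_replicate:
  assumes q: "set_pmf q \<subseteq> scenarios m" "\<And>x. x \<in> scenarios m \<Longrightarrow> pmf q x > 0"
    and w: "w \<in> words m n" "k \<le> n"
  shows "cond_expectation (replicate_pmf n q) X (history k w)
    = measure_pmf.expectation (replicate_pmf (n - k) q) (\<lambda>v. X (take k w @ v))"
proof -
  note sub = set_replicate_pmf_subset[OF q(1)]
  have pos: "pmf (replicate_pmf j q) v > 0" if "v \<in> words m j" for v j
    using that q by (auto simp: pmf_positive_iff set_replicate_pmf words_def)
  define u where "u = take k w"
  have u: "u \<in> words m k" using w take_in_words by (simp add: u_def)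
  have len: "length u = k" using u by (simp add: words_def)
  \<comment> \<open>The letters are independent, so the weight of the prefix factors out and cancels
    in the quotient by the mass.\<close>
  have "tail_sum (replicate_pmf n q) Y u
      = pmf (replicate_pmf k q) u * measure_pmf.expectation (replicate_pmf (n - k) q) (\<lambda>v. Y (u @ v))"
    for Y
    using pmf_replicate_append[of u "n - k" q] w(2)
    by (simp add: tail_sum_def len expectation_finite_sum[OF finite_words sub] sum_distrib_left mult.assoc)
  then show ?thesis
    using cond_expectation_eq[OF sub pos w, of X] pos[OF u] by (simp add: u_def)
qed

lemma expectation_move:
  assumes "one_step q" "i \<in> {1..m}"
  shows "measure_pmf.expectation q (move i) = R"
proof -
  have "measure_pmf.expectation q (move i)
      = D i * (\<Sum>x\<in>scenarios m. pmf q x) + (U i - D i) * (\<Sum>x\<in>scenarios m. pmf q x * up i x)"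
    unfolding expectation_finite_sum[OF finite_scenarios one_step_sum(1)[OF assms(1)]]
      sum_distrib_left sum.distrib[symmetric]
    by (rule sum.cong) (simp_all add: move_eq algebra_simps)
  then show ?thesis
    using model[OF assms(2)] one_step_sum(2,3)[OF assms(1)] assms(2) by (simp add: up_prob_def)
qed

lemma expectation_walk:
  assumes q: "one_step q" "i \<in> {1..m}" "l \<le> k"
  shows "measure_pmf.expectation (replicate_pmf k q) (\<lambda>w. walk i (take l w)) = R ^ l"
  using q(3)
proof (induction k arbitrary: l)
  case (Suc k)
  show ?case
  proof (cases l)
    case (Suc l')
    then have "measure_pmf.expectation (replicate_pmf k q) (\<lambda>w. walk i (take l' w)) = R ^ l'"
      using Suc.prems Suc.IH by simp
    then show ?thesis
      using Suc expectation_move[OF q(1,2)]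
      by (simp add: expectation_replicate_Suc[OF one_step_sum(1)[OF q(1)]] del: replicate_pmf.simps(2))
  qed simp
qed simp

text \<open>The price at time \<open>k + l\<close> is the price at time \<open>k\<close> times the
  factors of the next \<open>l\<close> letters, which are independent of the past and have mean
  \<open>R\<close> each.\<close>

lemma replicate_risk_neutral:
  assumes q: "one_step q" "\<And>x. x \<in> scenarios m \<Longrightarrow> pmf q x > 0"
  shows "replicate_pmf n q \<in> \<Gamma>"
proof -
  note set = one_step_sum(1)[OF q(1)]
  have "cond_expectation (replicate_pmf n q) (S i (k + l)) (history k w) = R ^ l * S i k w"
    if i: "i \<in> {1..m}" and w: "w \<in> words m n" and kl: "k + l \<le> n" for i w k l
  proof -
    have "S i (k + l) (take k w @ v) = S i k w * walk i (take l v)" if "v \<in> words m (n - k)" for v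
    proof -
      have "take k w @ v \<in> words m n"
        using append_in_words[OF take_in_words[OF w, of k] that] kl by simp
      then show ?thesis
        using kl i w that by (subst (1 2) stock_eq_walk) (auto simp: words_def)
    qed
    then have "measure_pmf.expectation (replicate_pmf (n - k) q) (\<lambda>v. S i (k + l) (take k w @ v))
        = S i k w * measure_pmf.expectation (replicate_pmf (n - k) q) (\<lambda>v. walk i (take l v))"
      by (simp add: expectation_finite_sum[OF finite_words set_replicate_pmf_subset[OF set]]
          sum_distrib_left mult.left_commute)
    then show ?thesis
      using cond_expectation_replicate[OF set q(2) w, of k] kl expectation_walk[OF q(1) i, of l "n - k"]
      by simp
  qed
  moreover have "pmf (replicate_pmf n q) w > 0" if "w \<in> words m n" for w
    using that q by (auto simp: pmf_positive_iff set_replicate_pmf words_def)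
  ultimately show ?thesis
    using set_replicate_pmf_subset[OF set] by (auto simp: risk_neutral_measures_def)
qed

text \<open>Let the assets move independently of each other; all up-probabilities lie strictly
  between 0 and 1.\<close>

lemma one_step_full_support:
  obtains q where "one_step q" "\<And>x. x \<in> scenarios m \<Longrightarrow> pmf q x > 0"
proof
  \<comment> \<open>Success is sent to 0, the letter value of an up-move. The default
    \<open>undefined\<close> of \<open>Pi_pmf\<close> below matches the extensional functions in
    \<open>scenarios m\<close>.\<close>
  define p where "p i = map_pmf (\<lambda>c. if c then 0 else 1 :: nat) (bernoulli_pmf (up_prob i))" for i
  define q where "q = Pi_pmf {1..m} undefined p"
  have set_p: "set_pmf (p i) = {0, 1}" if "i \<in> {1..m}" for i
    using up_prob_bounds[OF that] by (auto simp: p_def set_pmf_bernoulli UNIV_bool)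
  have set_q: "set_pmf q = scenarios m"
    using set_p by (auto simp: q_def set_Pi_pmf PiE_dflt_def scenarios_def PiE_def Pi_def extensional_def)
  show "pmf q x > 0" if "x \<in> scenarios m" for x
    using that set_q by (simp add: pmf_positive_iff)
  have "measure_pmf.expectation q (up i) = up_prob i" if i: "i \<in> {1..m}" for i
  proof -
    have "measure_pmf.expectation q (up i)
        = measure_pmf.expectation (map_pmf (\<lambda>x. x i) q) (\<lambda>y. of_bool (y = 0))"
      by (simp add: up_def[abs_def])
    also have "map_pmf (\<lambda>x. x i) q = p i"
      using i by (simp add: q_def Pi_pmf_component)
    finally show ?thesis
      using up_prob_bounds[OF i] by (simp add: p_def)
  qed
  then show "one_step q" using set_q by (simp add: one_step_def)
qed

lemma one_step_mixture:
  assumes "one_step p" "one_step q" "0 \<le> e" "e \<le> 1"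
  shows "one_step (mixture e p q)"
proof -
  have sub: "set_pmf (mixture e p q) \<subseteq> scenarios m"
    by (intro subset_trans[OF set_mixture_subset] Un_least one_step_sum(1) assms)
  have "measure_pmf.expectation (mixture e p q) (up i) = up_prob i" if i: "i \<in> {1..m}" for i
  proof -
    have "measure_pmf.expectation (mixture e p q) (up i)
        = e * (\<Sum>x\<in>scenarios m. pmf p x * up i x) + (1 - e) * (\<Sum>x\<in>scenarios m. pmf q x * up i x)"
      by (simp add: expectation_finite_sum[OF finite_scenarios sub] pmf_mixture assms distrib_right
          sum.distrib sum_distrib_left mult.assoc)
    also have "\<dots> = up_prob i"
      unfolding one_step_sum(3)[OF assms(1) i] one_step_sum(3)[OF assms(2) i] by (simp add: algebra_simps)
    finally show ?thesis .
  qed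
  then show ?thesis using sub by (simp add: one_step_def)
qed

text \<open>Backward induction gives the upper bound. For the lower bound, product measures of fully
  supported laws \<open>r j\<close> tending to \<open>q\<close> lie in \<open>\<Gamma>\<close>, and
  their values tend to the bound.\<close>

lemma SUP_cond_expectation:
  assumes q: "one_step q" "affine_majorized q G" and w: "w \<in> words m n" and k: "k \<le> n"
  shows "(SUP P\<in>\<Gamma>. cond_expectation P G (history (n - k) w))
    = measure_pmf.expectation (replicate_pmf k q) (\<lambda>v. G (take (n - k) w @ v))"
    (is "(SUP P\<in>\<Gamma>. ?H P) = ?E q")
proof (rule antisym)
  obtain p where p: "one_step p" "\<And>x. x \<in> scenarios m \<Longrightarrow> pmf p x > 0"
    using one_step_full_support by blast
  \<comment> \<open>A positive share of \<open>p\<close> gives every letter positive weight, and the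
    share tends to 0.\<close>
  define r where "r j = mixture (1 / real (Suc j)) p q" for j
  have r: "one_step (r j)" for j
    unfolding r_def using p(1) q(1) by (intro one_step_mixture) auto
  have r_pos: "pmf (r j) x > 0" if "x \<in> scenarios m" for j x
    unfolding r_def using p(2)[OF that] by (subst pmf_mixture) (auto intro!: add_pos_nonneg)
  have upper: "?H P \<le> ?E q" if P: "P \<in> \<Gamma>" for P
  proof -
    have v: "take (n - k) w \<in> words m (n - k)" using w take_in_words by simp
    have "mass P (take (n - k) w) > 0"
      using mass_pos[OF risk_neutralD(2)[OF P] v] by simp
    then show ?thesis
      using tail_sum_le_product_expectation[OF q P v, of k] k
      by (simp add: cond_expectation_eq[OF risk_neutralD(1,2)[OF P] w] field_simps)
  qed
  have ne: "\<Gamma> \<noteq> {}" using replicate_risk_neutral[OF r r_pos] by blast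
  show "(SUP P\<in>\<Gamma>. ?H P) \<le> ?E q"
    using upper by (intro cSUP_least ne)
  have "(\<lambda>j. ?E (r j)) \<longlonglongrightarrow> ?E q"
    unfolding expectation_finite_sum[OF finite_words set_replicate_pmf_subset[OF one_step_sum(1)[OF r]]]
      expectation_finite_sum[OF finite_words set_replicate_pmf_subset[OF one_step_sum(1)[OF q(1)]]]
  proof (intro tendsto_sum tendsto_mult tendsto_const)
    fix v assume "v \<in> words m k"
    then show "(\<lambda>j. pmf (replicate_pmf k (r j)) v) \<longlonglongrightarrow> pmf (replicate_pmf k q) v"
      using tendsto_pmf_replicate_mixture[of v p q] by (simp add: r_def words_def)
  qed
  moreover have "?E (r j) \<le> (SUP P\<in>\<Gamma>. ?H P)" for j
  proof -
    have "?H (replicate_pmf n (r j)) = ?E (r j)"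
      using cond_expectation_replicate[OF one_step_sum(1)[OF r] r_pos w, of "n - k" j G] k by simp
    moreover have "?H (replicate_pmf n (r j)) \<le> (SUP P\<in>\<Gamma>. ?H P)"
      using upper by (intro cSUP_upper bdd_aboveI2 replicate_risk_neutral r r_pos)
    ultimately show ?thesis by simp
  qed
  ultimately show "?E q \<le> (SUP P\<in>\<Gamma>. ?H P)"
    by (intro LIMSEQ_le_const2) auto
qed

section \<open>The pay-off as a function of one letter, and its affine bounds\<close>

lemma payoff_append:
  assumes "v @ w \<in> words m n"
  shows "payoff m n S0 D U C (v @ w) = max 0 ((\<Sum>i=1..m. S0 i * walk i v * walk i w) - C)"
proof -
  have "S i n (v @ w) = S0 i * walk i v * walk i w" if "i \<in> {1..m}" for i
    using assms that by (subst stock_eq_walk) (auto simp: words_def)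
  then show ?thesis by (simp add: payoff_def)
qed

text \<open>With the other \<open>n - 1\<close> letters fixed, each final price is a positive
  constant times \<open>move i x\<close>, which is affine in the up-indicator with positive
  slope.\<close>

lemma payoff_letter:
  assumes "v @ w \<in> words m (n - 1)" "1 \<le> n"
  obtains K a where "\<And>i. i \<in> {1..m} \<Longrightarrow> a i \<ge> 0"
    and "\<And>x. x \<in> scenarios m \<Longrightarrow>
      payoff m n S0 D U C (v @ x # w) = max 0 (K + (\<Sum>i=1..m. a i * up i x))"
proof
  let ?c = "\<lambda>i. S0 i * walk i v * walk i w"
  show "?c i * (U i - D i) \<ge> 0" if "i \<in> {1..m}" for i
    using model[OF that] walk_pos[OF that, of v] walk_pos[OF that, of w] by simp
  fix x assume "x \<in> scenarios m"
  then have "v @ x # w \<in> words m n" using assms by (auto simp: words_def)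
  then have "payoff m n S0 D U C (v @ x # w)
      = max 0 ((\<Sum>i=1..m. S0 i * walk i v * walk i (x # w)) - C)"
    by (rule payoff_append)
  also have "(\<Sum>i=1..m. S0 i * walk i v * walk i (x # w))
      = (\<Sum>i=1..m. ?c i * D i) + (\<Sum>i=1..m. ?c i * (U i - D i) * up i x)"
    unfolding sum.distrib[symmetric] by (rule sum.cong) (simp_all add: move_eq algebra_simps)
  finally show "payoff m n S0 D U C (v @ x # w)
      = max 0 (((\<Sum>i=1..m. ?c i * D i) - C) + (\<Sum>i=1..m. ?c i * (U i - D i) * up i x))"
    by (simp add: algebra_simps)
qed

lemma mu_in_scenarios: "mu m p \<in> scenarios m"
  by (auto simp: mu_def scenarios_def)

lemma nu_in_scenarios: "nu m p \<in> scenarios m"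
  by (auto simp: nu_def scenarios_def)

lemma up_mu: "i \<in> {1..m} \<Longrightarrow> up i (mu m p) = of_bool (i \<le> p)"
  by (auto simp: up_def mu_def)

lemma up_nu: "i \<in> {1..m} \<Longrightarrow> up i (nu m p) = of_bool (i = p)"
  by (auto simp: up_def nu_def)

text \<open>The greedy coefficients serve as \<open>\<beta>\<close>; equality holds at every
  \<open>mu m p\<close>, so only the support of \<open>q\<close> matters and not its
  weights.\<close>

lemma payoff_affine_majorized:
  assumes "1 \<le> n" "set_pmf q \<subseteq> mu m ` A"
  shows "affine_majorized q (payoff m n S0 D U C)"
  unfolding affine_majorized_def
proof (intro allI impI)
  fix v w assume "v @ w \<in> words m (n - 1)"
  then obtain K a where a: "\<And>i. i \<in> {1..m} \<Longrightarrow> a i \<ge> 0"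
    and F: "\<And>x. x \<in> scenarios m \<Longrightarrow>
      payoff m n S0 D U C (v @ x # w) = max 0 (K + (\<Sum>i=1..m. a i * up i x))"
    using payoff_letter[of v w C] assms(1) by metis
  define \<beta> where "\<beta> i = max 0 (K + sum a {1..i}) - max 0 (K + sum a {1..<i})" for i
  have "payoff m n S0 D U C (v @ x # w) \<le> max 0 K + (\<Sum>i=1..m. \<beta> i * up i x)"
    if "x \<in> scenarios m" for x
    unfolding F[OF that] \<beta>_def using a by (intro max_sum_le_greedy) (auto simp: up_def)
  moreover have "payoff m n S0 D U C (v @ x # w) = max 0 K + (\<Sum>i=1..m. \<beta> i * up i x)"
    if "x \<in> set_pmf q" for x
  proof -
    from that assms obtain p where "x = mu m p" by auto
    then show ?thesis
      unfolding \<open>x = mu m p\<close> F[OF mu_in_scenarios] \<beta>_def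
      by (intro max_sum_eq_greedy[where p=p] up_mu) simp
  qed
  ultimately show "\<exists>\<alpha> \<beta>.
      (\<forall>x\<in>scenarios m. payoff m n S0 D U C (v @ x # w) \<le> \<alpha> + (\<Sum>i=1..m. \<beta> i * up i x)) \<and>
      (\<forall>x\<in>set_pmf q. payoff m n S0 D U C (v @ x # w) = \<alpha> + (\<Sum>i=1..m. \<beta> i * up i x))"
    by blast
qed

text \<open>The infimum is treated as the supremum for the negated pay-off, whose majorant is the
  negative of the affine minorant with the separate coefficients.\<close>

lemma uminus_payoff_affine_majorized:
  assumes "1 \<le> n" "set_pmf q \<subseteq> nu m ` A"
  shows "affine_majorized q (\<lambda>w. - payoff m n S0 D U C w)"
  unfolding affine_majorized_def
proof (intro allI impI)
  fix v w assume "v @ w \<in> words m (n - 1)"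
  then obtain K a where a: "\<And>i. i \<in> {1..m} \<Longrightarrow> a i \<ge> 0"
    and F: "\<And>x. x \<in> scenarios m \<Longrightarrow>
      payoff m n S0 D U C (v @ x # w) = max 0 (K + (\<Sum>i=1..m. a i * up i x))"
    using payoff_letter[of v w C] assms(1) by metis
  define \<beta> where "\<beta> i = max 0 (K + a i) - max 0 K" for i
  have neg: "- max 0 K + (\<Sum>i=1..m. - \<beta> i * up i x) = - (max 0 K + (\<Sum>i=1..m. \<beta> i * up i x))" for x
    by (simp add: sum_negf)
  have "- payoff m n S0 D U C (v @ x # w) \<le> - max 0 K + (\<Sum>i=1..m. - \<beta> i * up i x)"
    if "x \<in> scenarios m" for x
    unfolding F[OF that] neg neg_le_iff_le unfolding \<beta>_def using a
    by (intro max_sum_ge_separate) (auto simp: up_def)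
  moreover have "- payoff m n S0 D U C (v @ x # w) = - max 0 K + (\<Sum>i=1..m. - \<beta> i * up i x)"
    if "x \<in> set_pmf q" for x
  proof -
    from that assms obtain p where "x = nu m p" by auto
    then show ?thesis
      unfolding \<open>x = nu m p\<close> F[OF nu_in_scenarios] neg neg_equal_iff_equal unfolding \<beta>_def
      by (intro max_sum_eq_separate[where p=p] up_nu) simp
  qed
  ultimately show "\<exists>\<alpha> \<beta>.
      (\<forall>x\<in>scenarios m. - payoff m n S0 D U C (v @ x # w) \<le> \<alpha> + (\<Sum>i=1..m. \<beta> i * up i x)) \<and>
      (\<forall>x\<in>set_pmf q. - payoff m n S0 D U C (v @ x # w) = \<alpha> + (\<Sum>i=1..m. \<beta> i * up i x))"
    by (intro exI[of _ "- max 0 K"] exI[of _ "\<lambda>i. - \<beta> i"]) blast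
qed

lemma expectation_payoff_multinomial:
  fixes x :: "nat \<Rightarrow> nat \<Rightarrow> nat"
  assumes q: "set_pmf q \<subseteq> scenarios m"
    and E: "\<And>g. measure_pmf.expectation q g = (\<Sum>j=0..m. c j * g (x j))"
    and x: "\<And>j. x j \<in> scenarios m"
    and v: "v \<in> words m (n - k)" "k \<le> n"
  shows "measure_pmf.expectation (replicate_pmf k q) (\<lambda>w. payoff m n S0 D U C (v @ w))
    = (\<Sum>a\<in>compositions m k. multinomial_weight m c k a
        * payoff m n S0 D U C (v @ block_word m x a))"
proof -
  \<comment> \<open>The multinomial lemma asks for symmetry on all lists. \<open>f\<close> has it,
    being built from \<open>walk\<close>, and it agrees with the pay-off after \<open>v\<close> on
    the words of length \<open>k\<close>.\<close>
  define f where "f w = max 0 ((\<Sum>i=1..m. S0 i * walk i v * walk i w) - C)" for w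
  have f: "payoff m n S0 D U C (v @ w) = f w" if "w \<in> words m k" for w
    unfolding f_def using append_in_words[OF v(1) that] v(2) by (intro payoff_append) simp
  have "measure_pmf.expectation (replicate_pmf k q) (\<lambda>w. payoff m n S0 D U C (v @ w))
      = measure_pmf.expectation (replicate_pmf k q) f"
    by (simp add: expectation_finite_sum[OF finite_words set_replicate_pmf_subset[OF q]] f)
  also have "\<dots> = (\<Sum>a\<in>compositions m k. multinomial_weight m c k a * f (block_word m x a))"
  proof (rule expectation_replicate_multinomial[OF q E])
    fix u w :: "(nat \<Rightarrow> nat) list" assume "mset u = mset w"
    then have "walk i u = walk i w" for i
      unfolding walk_def by (metis mset_map prod_mset_prod_list)
    then show "f u = f w" by (simp add: f_def)
  qed
  also have "\<dots> = (\<Sum>a\<in>compositions m k. multinomial_weight m c k a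
      * payoff m n S0 D U C (v @ block_word m x a))"
  proof (rule sum.cong[OF refl])
    fix a assume a: "a \<in> compositions m k"
    have "length (block_word m x a) = size (\<Sum>j=0..m. replicate_mset (a j) (x j))"
      by (simp flip: mset_block_word)
    also have "\<dots> = k" using a by (simp add: size_multiset_sum compositions_def)
    finally have "block_word m x a \<in> words m k"
      using x by (auto simp: words_def block_word_def)
    then show "multinomial_weight m c k a * f (block_word m x a)
        = multinomial_weight m c k a * payoff m n S0 D U C (v @ block_word m x a)"
      by (simp add: f)
  qed
  finally show ?thesis .
qed

end


section \<open>The extremal values\<close>

theorem theorem1p16:
  fixes m n k :: nat
    and R C :: real
    and D U S0 b :: "nat \<Rightarrow> real"
    and \<omega> \<theta> :: "(nat \<Rightarrow> nat) list"
    and F :: "(nat \<Rightarrow> nat) list \<Rightarrow> real"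
    and \<Gamma> :: "(nat \<Rightarrow> nat) list pmf set"
    and H :: "(nat \<Rightarrow> nat) list pmf \<Rightarrow> nat \<Rightarrow> (nat \<Rightarrow> nat) list \<Rightarrow> real"
  defines "b \<equiv> bcoef m R D U"
    and "F \<equiv> payoff m n S0 D U C"
    and "\<Gamma> \<equiv> risk_neutral_measures m n R S0 D U"
    and "H \<equiv> rational_value m n S0 D U C"
    and "\<theta> \<equiv> take (n - k) \<omega>"
  assumes "m \<ge> 1" and "n \<ge> 1" and "R \<ge> 1" and "C \<ge> 0"
    and "\<And>i. 1 \<le> i \<Longrightarrow> i \<le> m \<Longrightarrow> 0 < D i \<and> D i < R \<and> R < U i \<and> S0 i > 0"
    and "\<And>i j. 1 \<le> i \<Longrightarrow> i \<le> j \<Longrightarrow> j \<le> m \<Longrightarrow> b i \<ge> b j"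
    and "\<Gamma> \<noteq> {}"
    and "\<omega> \<in> words m n"
    and "1 \<le> k" and "k \<le> n"
  shows "(SUP P\<in>\<Gamma>. H P (n - k) \<omega>)
           = product_expectation (upper_density m b) k (\<lambda>\<tau>. F (\<theta> @ \<tau>))
       \<and> product_expectation (upper_density m b) k (\<lambda>\<tau>. F (\<theta> @ \<tau>))
           = (\<Sum>a\<in>compositions m k.
                fact k / (\<Prod>j=0..m. fact (a j)) * (\<Prod>j=0..m. upper_coef b j ^ a j)
                  * F (\<theta> @ block_word m (mu m) a))
       \<and> ((\<Sum>i=1..m. b i) / real m \<le> 2 / real m - 1 \<longrightarrow>
           (INF P\<in>\<Gamma>. H P (n - k) \<omega>)
             = product_expectation (lower_density m b) k (\<lambda>\<tau>. F (\<theta> @ \<tau>))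
         \<and> product_expectation (lower_density m b) k (\<lambda>\<tau>. F (\<theta> @ \<tau>))
             = (\<Sum>a\<in>compositions m k.
                  fact k / (\<Prod>j=0..m. fact (a j)) * (\<Prod>j=0..m. lower_coef m b j ^ a j)
                    * F (\<theta> @ block_word m (nu m) a)))"
proof -
  interpret bm: binomial_model m n R D U S0
    using assms(6,10) by unfold_locales auto
  have b0: "b 0 = 1" and bm: "b (m + 1) = - 1"
    by (simp_all add: b_def bcoef_def)
  \<comment> \<open>The link to the model: \<open>b i\<close> is the up-probability rescaled from
    the interval from 0 to 1 to that from -1 to 1.\<close>
  have b_up: "(b i + 1) / 2 = bm.up_prob i" if i: "i \<in> {1..m}" for i
  proof -
    have "U i - D i \<noteq> 0" using bm.model[OF i] by simp
    then show ?thesis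
      using i by (simp add: b_def bcoef_def bm.up_prob_def field_simps)
  qed
  have b_bounds: "- 1 < b i" "b i < 1" if "i \<in> {1..m}" for i
    using b_up[OF that] bm.up_prob_bounds[OF that] by (simp_all add: field_simps)
  have k: "k \<le> n" "1 \<le> n" and \<theta>: "\<theta> \<in> words m (n - k)"
    using assms by (simp_all add: take_in_words)
  define Q where "Q = embed_pmf (upper_density m b)"
  have upper_nonneg: "upper_coef b j \<ge> 0" if "j \<in> {0..m}" for j
  proof -
    \<comment> \<open>The values \<open>b 0 = 1\<close> and \<open>b (m + 1) = - 1\<close> extend
      the decreasing order of the \<open>b i\<close>, all of which lie strictly between
      them.\<close>
    consider "j = 0" | "1 \<le> j" "j < m" | "j \<ge> 1" "j = m" using \<open>j \<in> {0..m}\<close> by force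
    then have "b (j + 1) \<le> b j"
    proof cases
      case 1 then show ?thesis using b_bounds(2)[of 1] b0 \<open>m \<ge> 1\<close> by simp
    next
      case 2 then show ?thesis using assms(11)[of j "j + 1"] by simp
    next
      case 3 then show ?thesis using b_bounds(1)[of m] bm \<open>m \<ge> 1\<close> by simp
    qed
    then show ?thesis by (simp add: upper_coef_def)
  qed
  \<comment> \<open>A telescoping sum: for \<open>i = 0\<close> it is the total mass, for
    \<open>i \<ge> 1\<close> the mass of those \<open>mu m j\<close> in which asset \<open>i\<close>
    is up, namely \<open>j \<ge> i\<close>.\<close>
  have upper_sum: "(\<Sum>j=i..m. upper_coef b j) = (b i + 1) / 2" if "i \<le> m" for i
    using sum_natinterval_diff[of b i m] that bm
    by (simp add: upper_coef_def flip: sum_divide_distrib)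
  have "sum (upper_coef b) {0..m} = 1" using upper_sum[of 0] b0 by simp
  note Q = embed_pmf_indicator_sum[of "{0..m}" "upper_coef b" "mu m", OF _ upper_nonneg this,
      folded upper_density_def, folded Q_def, simplified]
  have Q_scen: "set_pmf Q \<subseteq> scenarios m"
    using Q(1) bm.mu_in_scenarios by blast
  have "measure_pmf.expectation Q (bm.up i) = bm.up_prob i" if i: "i \<in> {1..m}" for i
  proof -
    have "measure_pmf.expectation Q (bm.up i)
        = (\<Sum>j=0..m. if j \<in> {i..m} then upper_coef b j else 0)"
      unfolding Q(2) by (rule sum.cong) (auto simp: bm.up_mu[OF i])
    also have "\<dots> = (\<Sum>j\<in>{0..m} \<inter> {i..m}. upper_coef b j)"
      by (rule sum.inter_restrict[symmetric]) simp
    also have "{0..m} \<inter> {i..m} = {i..m}" by auto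
    finally show ?thesis using i upper_sum[of i] b_up[OF i] by simp
  qed
  then have Q_step: "bm.one_step Q" using Q_scen by (simp add: bm.one_step_def)
  have upper1: "(SUP P\<in>\<Gamma>. H P (n - k) \<omega>)
      = product_expectation (upper_density m b) k (\<lambda>\<tau>. F (\<theta> @ \<tau>))"
    using bm.SUP_cond_expectation[OF Q_step bm.payoff_affine_majorized[OF k(2) Q(1)] assms(13) k(1), of C]
    by (simp add: \<Gamma>_def H_def F_def \<theta>_def rational_value_def product_expectation_def Q_def)
  have upper2: "product_expectation (upper_density m b) k (\<lambda>\<tau>. F (\<theta> @ \<tau>))
      = (\<Sum>a\<in>compositions m k.
           fact k / (\<Prod>j=0..m. fact (a j)) * (\<Prod>j=0..m. upper_coef b j ^ a j)
             * F (\<theta> @ block_word m (mu m) a))"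
    using bm.expectation_payoff_multinomial[OF Q_scen Q(2) bm.mu_in_scenarios \<theta> k(1), of C]
    by (simp add: product_expectation_def F_def multinomial_weight_def flip: Q_def)
  have lower: "(INF P\<in>\<Gamma>. H P (n - k) \<omega>)
        = product_expectation (lower_density m b) k (\<lambda>\<tau>. F (\<theta> @ \<tau>))
      \<and> product_expectation (lower_density m b) k (\<lambda>\<tau>. F (\<theta> @ \<tau>))
        = (\<Sum>a\<in>compositions m k.
             fact k / (\<Prod>j=0..m. fact (a j)) * (\<Prod>j=0..m. lower_coef m b j ^ a j)
               * F (\<theta> @ block_word m (nu m) a))"
    if small: "(\<Sum>i=1..m. b i) / real m \<le> 2 / real m - 1"
  proof -
    define q where "q = embed_pmf (lower_density m b)"
    have "(\<Sum>i=1..m. b i) \<le> 2 - real m"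
      using small \<open>m \<ge> 1\<close> by (simp add: field_simps)
    \<comment> \<open>The extra assumption says that the up-probabilities add up to at most 1, which
      leaves a nonnegative weight for \<open>nu m 0\<close>.\<close>
    then have "(\<Sum>i=1..m. (b i + 1) / 2) \<le> 1"
      by (simp add: sum.distrib flip: sum_divide_distrib)
    then have lower_nonneg: "lower_coef m b j \<ge> 0" if "j \<in> {0..m}" for j
      using that b_bounds(1)[of j] by (auto simp: lower_coef_def)
    have "sum (lower_coef m b) {0..m} = lower_coef m b 0 + sum (lower_coef m b) {1..m}"
      by (simp add: sum.atLeast_Suc_atMost)
    also have "sum (lower_coef m b) {1..m} = (\<Sum>i=1..m. (b i + 1) / 2)"
      by (rule sum.cong) (auto simp: lower_coef_def)
    finally have "sum (lower_coef m b) {0..m} = 1"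
      by (simp add: lower_coef_def)
    note q = embed_pmf_indicator_sum[of "{0..m}" "lower_coef m b" "nu m", OF _ lower_nonneg this,
        folded lower_density_def, folded q_def, simplified]
    have q_scen: "set_pmf q \<subseteq> scenarios m"
      using q(1) bm.nu_in_scenarios by blast
    have "measure_pmf.expectation q (bm.up i) = bm.up_prob i" if i: "i \<in> {1..m}" for i
    proof -
      \<comment> \<open>Asset \<open>i\<close> is up in \<open>nu m i\<close> alone.\<close>
      have "measure_pmf.expectation q (bm.up i) = (\<Sum>j=0..m. if j = i then lower_coef m b j else 0)"
        unfolding q(2) by (rule sum.cong) (auto simp: bm.up_nu[OF i])
      then show ?thesis using i b_up[OF i] by (simp add: lower_coef_def)
    qed
    then have q_step: "bm.one_step q" using q_scen by (simp add: bm.one_step_def)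
    \<comment> \<open>Passing to the negated pay-off makes the result on suprema applicable.\<close>
    have "(INF P\<in>\<Gamma>. H P (n - k) \<omega>) = - (SUP P\<in>\<Gamma>. - H P (n - k) \<omega>)"
      by (simp add: Inf_real_def image_image)
    also have "\<dots> = product_expectation (lower_density m b) k (\<lambda>\<tau>. F (\<theta> @ \<tau>))"
      using bm.SUP_cond_expectation[OF q_step
          bm.uminus_payoff_affine_majorized[OF k(2) q(1)] assms(13) k(1), of C]
      by (simp add: \<Gamma>_def H_def F_def \<theta>_def rational_value_def cond_expectation_def
          product_expectation_def q_def)
    finally show ?thesis
      using bm.expectation_payoff_multinomial[OF q_scen q(2) bm.nu_in_scenarios \<theta> k(1), of C]
      by (simp add: product_expectation_def F_def multinomial_weight_def flip: q_def)
  qed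
  show ?thesis using upper1 upper2 lower by blast
qed

end
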